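(* Let $q$ be a prime power, let $n,m\ge 2$ be integers with $m\ge n+1$, and let $1\le d\le n-1$ be an integer. There exists an $\mathbb{F}_q$-linear code $\mathcal{C}\le\mathbb{F}_q^{n\times m}$ of minimum rank distance $d$ with the following properties: (1) $\mathcal{C}$ is not MRD; (2) $\mathcal{C}$ is not dually QMRD; (3) the minimum weight codewords of $\mathcal{C}$ hold the trivial design, i.e. $\{\sigma(X):X\in\mathcal{C},\ \mathrm{rk}(X)=d\}$ is the set of all $d$-dimensional subspaces of $\mathbb{F}_q^n$.
   Context: For a nonzero $\mathbb{F}_q$-linear subspace (code) $\mathcal{C}\le\mathbb{F}_q^{n\times m}$, its minimum rank distance is $d_{\mathrm{rk}}(\mathcal{C})=\min\{\mathrm{rk}(X):X\in\mathcal{C},X\ne0\}$. The dual code is $\mathcal{C}^*=\{Y\in\mathbb{F}_q^{n\times m}:\mathrm{Tr}(XY^\top)=0\text{ for all }X\in\mathcal{C}\}$. The code $\mathcal{C}$ with $d=d_{\mathrm{rk}}(\mathcal{C})$ is MRD if $\dim_{\mathbb{F}_q}\mathcal{C}=\max\{n,m\}(\min\{n,m\}-d+1)$. It is dually QMRD if $d_{\mathrm{rk}}(\mathcal{C})+d_{\mathrm{rk}}(\mathcal{C}^* )=\min\{m,n\}+1$. The support $\sigma(X)\le\mathbb{F}_q^n$ of $X\in\mathbb{F}_q^{n\times m}$ is its column space. *)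

theory Defs
  imports "HOL-Analysis.Analysis"
begin

(* An n x m matrix over F_q is an element of 'a ^ 'm ^ 'n with q = CARD('a), n = CARD('n) and
   m = CARD('m): the outer index selects the row. *)

definition mat_scale :: "'a::field \<Rightarrow> 'a ^ 'm ^ 'n \<Rightarrow> 'a ^ 'm ^ 'n" where
  "mat_scale c X = (\<chi> i j. c * X $ i $ j)"

global_interpretation mat_vs: vector_space "mat_scale :: 'a::field \<Rightarrow> 'a ^ 'm ^ 'n \<Rightarrow> 'a ^ 'm ^ 'n"
  by unfold_locales (simp_all add: mat_scale_def vec_eq_iff algebra_simps)

(* Meaningful only for codes containing a nonzero matrix (otherwise it is Min {}). *)
definition min_rank_dist :: "('a::{field,finite} ^ 'm ^ 'n) set \<Rightarrow> nat" where
  "min_rank_dist C = Min {rank X | X. X \<in> C \<and> X \<noteq> 0}"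

definition dual_code :: "('a::{field,finite} ^ 'm ^ 'n) set \<Rightarrow> ('a ^ 'm ^ 'n) set" where
  "dual_code C = {Y. \<forall>X\<in>C. trace (X ** transpose Y) = 0}"

(* The subtraction on nat does not truncate for nonzero codes, since ranks are at most min n m. *)
definition MRD :: "('a::{field,finite} ^ 'm ^ 'n) set \<Rightarrow> bool" where
  "MRD C \<longleftrightarrow>
     mat_vs.dim C = max CARD('n) CARD('m) * (min CARD('n) CARD('m) - min_rank_dist C + 1)"

(* Meaningful only if the dual is nonzero. The dual is zero only for the full matrix space,
   which is MRD, so this is no restriction for codes that are not MRD. *)
definition dually_QMRD :: "('a::{field,finite} ^ 'm ^ 'n) set \<Rightarrow> bool" where
  "dually_QMRD C \<longleftrightarrow>
     min_rank_dist C + min_rank_dist (dual_code C) = min CARD('m) CARD('n) + 1"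

definition col_support :: "'a::field ^ 'm ^ 'n \<Rightarrow> ('a ^ 'n) set" where
  "col_support X = vec.span (columns X)"

end

theory Submission
  imports "HOL-Algebra.Algebraic_Closure_Type" Defs
begin

text \<open>
  Write \<open>q\<close>, \<open>n\<close>, \<open>m\<close> for the cardinalities of the field and of the two index types. A square
  Gabidulin code of minimum distance \<open>d\<close> already holds the trivial design. Appending \<open>m - n\<close>
  zero columns changes neither ranks nor supports, but it spoils both optimality properties.
  The dimension stays at most \<open>n * (n - d + 1)\<close>, which is less than the value
  \<open>m * (n - d + 1)\<close> required of an MRD code. The dual now contains a matrix unit supported in a
  zero column, so its minimum distance is \<open>1\<close>; being dually QMRD would force \<open>d = n\<close>.

  The Gabidulin code consists of the matrices, in coordinates, of the maps
  \<open>x \<mapsto> (\<Sum>i<r. a i * x ^ (q ^ i))\<close> on the extension field \<open>L\<close> of degree \<open>n\<close>, where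
  \<open>r = n - d + 1\<close> and the \<open>a i\<close> range over \<open>L\<close>. These maps are linear over the ground field,
  and a nonzero one has at most \<open>q ^ (r - 1)\<close> roots, so the rank of a nonzero codeword is at
  least \<open>d\<close> (\<open>rank_represents\<close>). A subspace \<open>U\<close> of dimension \<open>d\<close> is given by \<open>r - 1\<close> linear
  equations; since there are \<open>r\<close> coefficients, some nonzero codeword satisfies all of
  them (\<open>gabidulin_support_in\<close>). Its support lies in \<open>U\<close> and has dimension at least \<open>d\<close>,
  hence it equals \<open>U\<close>.

  The field \<open>L\<close> is constructed as the set of roots of \<open>x ^ (q ^ n) = x\<close> in the algebraic
  closure; separability of this equation gives it \<open>q ^ n\<close> elements (\<open>card_frob_fixed\<close>).
\<close>

(* Frees the letter X, which denotes matrices below, from its use as the polynomial variable. *)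
no_notation Polynomials.var (\<open>X\<index>\<close>)

section \<open>Counting and rank over finite fields\<close>

lemma (in vector_space) card_span_independent:
  assumes "independent B" "finite B"
  shows "card (span B) = CARD('a) ^ card B"
proof -
  let ?c = "\<lambda>u. \<Sum>v\<in>B. u v *s v"
  have "bij_betw ?c (B \<rightarrow>\<^sub>E UNIV) (span B)"
  proof (rule bij_betwI')
    fix u w assume u: "u \<in> B \<rightarrow>\<^sub>E (UNIV :: 'a set)" and w: "w \<in> B \<rightarrow>\<^sub>E (UNIV :: 'a set)"
    show "(?c u = ?c w) = (u = w)"
    proof
      assume "?c u = ?c w"
      then have "(\<Sum>v\<in>B. (u v - w v) *s v) = 0"
        by (simp add: scale_left_diff_distrib sum_subtractf)
      then have "u v = w v" if "v \<in> B" for v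
        using independentD[OF assms(1,2) subset_refl, of "\<lambda>v. u v - w v"] that by auto
      then show "u = w" using u w by (blast intro: PiE_ext)
    qed simp
  next
    fix u show "?c u \<in> span B" by (intro span_sum span_scale span_base)
  next
    fix x assume "x \<in> span B"
    then obtain u where "x = ?c u" unfolding span_finite[OF assms(2)] by blast
    then show "\<exists>u\<in>B \<rightarrow>\<^sub>E UNIV. x = ?c u"
      by (intro bexI[of _ "restrict u B"]) auto
  qed
  then show ?thesis
    using bij_betw_same_card card_PiE[OF assms(2), of "\<lambda>_. UNIV :: 'a set"] by fastforce
qed

lemma (in vector_space) card_finite_subspace:
  assumes "subspace S" "finite S"
  shows "card S = CARD('a) ^ dim S"
proof -
  obtain B where B: "B \<subseteq> S" "independent B" "S \<subseteq> span B" "card B = dim S"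
    using basis_exists by blast
  moreover have "span B = S"
    using B assms(1) by (intro antisym span_minimal)
  ultimately show ?thesis
    using card_span_independent[of B] assms(2) finite_subset by metis
qed

lemma CARD_field_ge_2: "2 \<le> CARD('a::{field,finite})"
proof -
  have "card {0, 1 :: 'a} \<le> CARD('a)" by (intro card_mono) auto
  then show ?thesis by simp
qed

lemma rank_eq_0_iff:
  fixes X :: "'a::field ^ 'm ^ 'n"
  shows "Cartesian_Space.rank X = 0 \<longleftrightarrow> X = 0"
  by (fastforce simp: row_rank_def_gen rows_def row_def vec_eq_iff)

text \<open>
  Expand every column of \<open>X\<close> in a basis of the column space. Comparing the entries in
  position \<open>i\<close> shows that row \<open>i\<close> is a combination of the coefficient vectors, one for each
  basis element.
\<close>

lemma dim_rows_le_dim_columns_field: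
  fixes X :: "'a::field ^ 'm ^ 'n"
  shows "vec.dim (rows X) \<le> vec.dim (columns X)"
proof -
  obtain B where B: "B \<subseteq> columns X" "vec.independent B" "columns X \<subseteq> vec.span B"
    "card B = vec.dim (columns X)"
    using vec.basis_exists by blast
  have finB: "finite B" using B(2) vec.finiteI_independent by blast
  define u where "u k = vec.representation B (column k X)" for k
  have col: "column k X = (\<Sum>b\<in>B. u k b *s b)" for k
    unfolding u_def using B
    by (intro vec.sum_representation_eq[symmetric] finB) (auto simp: columns_def)
  have "rows X \<subseteq> vec.span ((\<lambda>b. \<chi> k. u k b) ` B)"
  proof
    fix v assume "v \<in> rows X"
    then obtain i where v: "v = row i X" by (auto simp: rows_def)
    have "v = (\<Sum>b\<in>B. b $ i *s (\<chi> k. u k b))"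
    proof (simp add: vec_eq_iff v row_def, rule allI)
      fix k
      have "X $ i $ k = column k X $ i" by (simp add: column_def)
      also have "\<dots> = (\<Sum>b\<in>B. b $ i * u k b)" by (subst col) (simp add: mult.commute)
      finally show "X $ i $ k = (\<Sum>b\<in>B. b $ i * u k b)" .
    qed
    then show "v \<in> vec.span ((\<lambda>b. \<chi> k. u k b) ` B)"
      by (metis (no_types, lifting) imageI vec.span_base vec.span_scale vec.span_sum)
  qed
  then have "vec.dim (rows X) \<le> card ((\<lambda>b. \<chi> k. u k b) ` B)"
    using finB by (intro vec.dim_le_card) auto
  also have "\<dots> \<le> card B" using finB by (rule card_image_le)
  finally show ?thesis using B(4) by simp
qed

text \<open>
  The rank is defined through the rows, whereas the support of a codeword is its column space;
  this equality connects the two over an arbitrary field.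
\<close>

lemma rank_eq_dim_columns:
  fixes X :: "'a::field ^ 'm ^ 'n"
  shows "rank X = vec.dim (columns X)"
  using dim_rows_le_dim_columns_field[of X] dim_rows_le_dim_columns_field[of "transpose X"]
  by (simp add: row_rank_def_gen)

text \<open>
  A counting form of rank-nullity: \<open>x\<close> is determined by \<open>g x\<close> and by its difference from a
  fixed preimage of \<open>g x\<close>, which lies in the kernel.
\<close>

lemma card_UNIV_le_range_times_kernel:
  fixes g :: "'v::{ab_group_add,finite} \<Rightarrow> 'w::ab_group_add"
  assumes "\<And>x y. g (x - y) = g x - g y"
  shows "CARD('v) \<le> card (range g) * card {x. g x = 0}"
proof -
  let ?s = "inv_into UNIV g"
  have s: "g (?s (g x)) = g x" for x by (simp add: f_inv_into_f)
  have "inj (\<lambda>x. (g x, x - ?s (g x)))" by (rule injI) auto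
  then have "CARD('v) \<le> card (range g \<times> {x. g x = 0})"
    by (rule card_inj_on_le) (auto simp: assms s)
  then show ?thesis by (simp add: card_cartesian_product)
qed

text \<open>
  Extend a basis of \<open>U\<close> to one of the whole space. A vector lies in \<open>U\<close> as soon as its
  coordinates at the added basis vectors vanish, and these coordinates are linear forms.
\<close>

lemma subspace_equations:
  fixes U :: "('a::field ^ 'n) set"
  assumes "vec.subspace U"
  obtains P where "finite P" "card P \<le> CARD('n) - vec.dim U"
    "\<And>x. (\<And>p. p \<in> P \<Longrightarrow> (\<Sum>i\<in>UNIV. p $ i * x $ i) = 0) \<Longrightarrow> x \<in> U"
proof -
  obtain B where B: "B \<subseteq> U" "vec.independent B" "U \<subseteq> vec.span B" "card B = vec.dim U"
    using vec.basis_exists by blast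
  define E where "E = vec.extend_basis B"
  have E: "B \<subseteq> E" "vec.independent E" "vec.span E = UNIV"
    using vec.extend_basis_superset[OF B(2)] vec.independent_extend_basis[OF B(2)]
      vec.span_extend_basis[OF B(2)] by (auto simp: E_def)
  have finE: "finite E" using E(2) vec.finiteI_independent by blast
  have cardE: "card E = CARD('n)"
    using vec.dim_eq_card[OF _ E(2), of UNIV, unfolded vec.span_UNIV, OF E(3)] by (simp add: vec.dimension_def card_cart_basis)
  define eqn where "eqn w = (\<chi> i. vec.representation E (axis i 1) w)" for w
  have rep: "vec.representation E x w = (\<Sum>i\<in>UNIV. eqn w $ i * x $ i)" for x w
  proof -
    have "vec.representation E x w = vec.representation E (\<Sum>i\<in>UNIV. x $ i *s axis i 1) w"
      by (simp add: basis_expansion)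
    also have "\<dots> = (\<Sum>i\<in>UNIV. x $ i * vec.representation E (axis i 1) w)"
      by (subst vec.representation_sum) (simp_all add: E vec.representation_scale)
    finally show ?thesis by (simp add: eqn_def mult.commute)
  qed
  show ?thesis
  proof (rule that[of "eqn ` (E - B)"])
    show "finite (eqn ` (E - B))" using finE by simp
    have "card (eqn ` (E - B)) \<le> card (E - B)" using finE by (intro card_image_le) simp
    also have "\<dots> = CARD('n) - vec.dim U"
      using card_Diff_subset[OF _ E(1)] finE E(1) finite_subset cardE B(4) by metis
    finally show "card (eqn ` (E - B)) \<le> CARD('n) - vec.dim U" .
    fix x assume x: "\<And>p. p \<in> eqn ` (E - B) \<Longrightarrow> (\<Sum>i\<in>UNIV. p $ i * x $ i) = 0"
    have "x = (\<Sum>w\<in>E. vec.representation E x w *s w)"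
      using E finE by (intro vec.sum_representation_eq[symmetric]) auto
    also have "\<dots> = (\<Sum>w\<in>B. vec.representation E x w *s w)"
      using finE E(1) x by (intro sum.mono_neutral_right) (auto simp: rep)
    also have "\<dots> \<in> U"
      using B(1) by (intro vec.subspace_sum vec.subspace_scale assms) auto
    finally show "x \<in> U" .
  qed
qed

lemma ex_subspace_dim:
  assumes "d \<le> CARD('n)"
  shows "\<exists>U :: ('a::field ^ 'n) set. vec.subspace U \<and> vec.dim U = d"
proof -
  obtain T :: "('a ^ 'n) set" where T: "T \<subseteq> cart_basis" "card T = d"
    using assms obtain_subset_with_card_n[of d "cart_basis :: ('a ^ 'n) set"]
    by (metis card_cart_basis)
  then have "vec.independent T"
    using vec.independent_mono independent_cart_basis by blast
  then have "vec.dim (vec.span T) = d"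
    using T(2) by (simp add: vec.dim_eq_card_independent)
  then show ?thesis using vec.subspace_span by blast
qed

section \<open>The extension field inside the algebraic closure\<close>

lemma finite_field_power_CARD:
  fixes x :: "'a::{field,finite}"
  shows "x ^ CARD('a) = x"
proof (cases "x = 0")
  case False
  have "(\<Prod>y\<in>UNIV-{0}. x * y) = (\<Prod>y\<in>UNIV-{0}. y)"
    by (rule prod.reindex_bij_witness[of _ "\<lambda>y. y / x" "\<lambda>y. x * y"]) (use False in auto)
  then have "x ^ (CARD('a) - 1) * \<Prod>(UNIV-{0}) = 1 * \<Prod>(UNIV-{0})"
    by (simp add: prod.distrib)
  then have "x ^ (CARD('a) - 1) = 1" by simp
  then have "x * x ^ (CARD('a) - 1) = x" by simp
  then show ?thesis by (simp flip: power_Suc)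
qed simp

text \<open>
  The Frobenius identity \<open>(x + y)\<^sup>q = x\<^sup>q + y\<^sup>q\<close> rests on the vanishing of the inner binomial
  coefficients. It is obtained here without knowing that \<open>q\<close> is a prime power: the polynomial
  \<open>(X + 1)\<^sup>q - (X\<^sup>q + 1)\<close> has degree below \<open>q\<close> and vanishes on all \<open>q\<close> elements of the field,
  so it is zero.
\<close>

lemma CARD_choose_eq_0:
  assumes "0 < i" "i < CARD('a::{field,finite})"
  shows "of_nat (CARD('a) choose i) = (0 :: 'a)"
proof -
  let ?q = "CARD('a)"
  define p where "p = [:1, 1:] ^ ?q - (monom 1 ?q + 1 :: 'a poly)"
  have c: "coeff p j = of_nat (?q choose j)" if "0 < j" "j < ?q" for j
    using that by (simp add: p_def coeff_linear_poly_power coeff_eq_0)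
  have d: "degree p < ?q"
  proof (rule degree_lessI)
    show "\<forall>k\<ge>?q. coeff p k = 0"
    proof (intro allI impI)
      fix k assume k: "?q \<le> k"
      show "coeff p k = 0"
      proof (cases "k = ?q")
        case True then show ?thesis by (simp add: p_def coeff_linear_poly_power coeff_eq_0)
      next
        case False
        then have "degree ([:1, 1 :: 'a:] ^ ?q) < k"
          using k by (subst degree_linear_power) simp
        then show ?thesis using False k by (simp add: p_def coeff_eq_0)
      qed
    qed
  qed simp
  have "p = 0"
  proof (rule ccontr)
    assume "p \<noteq> 0"
    have "{x. poly p x = 0} = UNIV"
      by (auto simp: p_def poly_monom finite_field_power_CARD)
    then show False using card_poly_roots_bound[OF \<open>p \<noteq> 0\<close>] d by simp
  qed
  then show ?thesis using c[OF assms] by simp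
qed

lemma frobenius_add:
  fixes x y :: "'a::{field,finite} alg_closure"
  shows "(x + y) ^ (CARD('a) ^ i) = x ^ (CARD('a) ^ i) + y ^ (CARD('a) ^ i)"
proof (induction i)
  case (Suc i)
  have step: "(x + y) ^ CARD('a) = x ^ CARD('a) + y ^ CARD('a)" for x y :: "'a alg_closure"
  proof -
    have "(x + y) ^ CARD('a) = (\<Sum>k\<le>CARD('a). of_nat (CARD('a) choose k) * x ^ k * y ^ (CARD('a) - k))"
      by (rule binomial_ring)
    also have "\<dots> = (\<Sum>k\<in>{0, CARD('a)}. of_nat (CARD('a) choose k) * x ^ k * y ^ (CARD('a) - k))"
    proof (intro sum.mono_neutral_right ballI)
      fix k assume "k \<in> {..CARD('a)} - {0, CARD('a)}"
      then have "of_nat (CARD('a) choose k) = (0 :: 'a)"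
        by (intro CARD_choose_eq_0) auto
      then have "to_ac (of_nat (CARD('a) choose k) :: 'a) = 0" by simp
      then show "of_nat (CARD('a) choose k) * x ^ k * y ^ (CARD('a) - k) = 0" by simp
    qed auto
    finally show ?thesis by (simp add: add_ac)
  qed
  show ?case by (simp only: power_Suc2 power_mult Suc.IH step)
qed simp

lemma frobenius_to_ac:
  fixes c :: "'a::{field,finite}"
  shows "to_ac c ^ (CARD('a) ^ i) = to_ac c"
  by (induction i) (simp_all only: power_Suc2 power_mult power_0 power_one_right
      finite_field_power_CARD flip: to_ac_power)

text \<open>
  The extension field of degree \<open>n\<close>, realised inside the algebraic closure as the fixed
  points of the \<open>n\<close>-th power of the Frobenius map. As a set inside a fixed type it exists for
  every \<open>n\<close>, which a type depending on \<open>n\<close> could not provide.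
\<close>

definition frob_fixed :: "nat \<Rightarrow> 'a::{field,finite} alg_closure set" where
  "frob_fixed n = {x. x ^ (CARD('a) ^ n) = x}"

text \<open>
  The polynomial \<open>X\<close> to the power \<open>q^n\<close>, minus \<open>X\<close>, has derivative \<open>-1\<close> in characteristic
  dividing \<open>q\<close>. It therefore has no multiple root, and over the algebraic closure it has as
  many roots as its degree.
\<close>

lemma card_frob_fixed:
  assumes "0 < n"
  shows "card (frob_fixed n :: 'a::{field,finite} alg_closure set) = CARD('a) ^ n"
proof -
  let ?Q = "CARD('a) ^ n"
  define p :: "'a alg_closure poly" where "p = monom 1 ?Q + [:0, -1:]"
  have Q: "1 < ?Q" using CARD_field_ge_2[where 'a='a] assms by (intro one_less_power) auto
  have deg: "degree p = ?Q"
    unfolding p_def using Q by (subst degree_add_eq_left) (auto simp: degree_monom_eq)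
  then have p0: "p \<noteq> 0" using Q by auto
  have char: "of_nat ?Q = (0 :: 'a alg_closure)"
  proof -
    have "of_nat CARD('a) = (0 :: 'a)"
      using CARD_choose_eq_0[where 'a='a, of 1] CARD_field_ge_2[where 'a='a] by simp
    then have "to_ac (of_nat CARD('a) :: 'a) = 0" by simp
    then show ?thesis using assms by simp
  qed
  have der: "pderiv p = [:-1:]"
    using char by (simp add: p_def pderiv_add pderiv_monom pderiv_pCons)
  obtain A where A: "size A = degree p" "p = smult (lead_coeff p) (\<Prod>x\<in>#A. [:-x, 1:])"
    using alg_closed_imp_factorization[OF p0] by blast
  have cnt: "count A x \<le> 1" for x
  proof (rule ccontr)
    assume "\<not> count A x \<le> 1"
    \<comment> \<open>A repeated root would also be a root of the derivative, which is the constant -1.\<close>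
    then have "{#x, x#} \<subseteq># A"
      by (auto simp: subseteq_mset_def)
    then obtain B where "A = {#x, x#} + B" by (metis subset_mset.le_iff_add)
    then have "p = [:-x, 1:] * ([:-x, 1:] * smult (lead_coeff p) (\<Prod>x\<in>#B. [:-x, 1:]))"
      using A(2) by (simp add: mult_smult_right flip: mult.assoc)
    then obtain g where "p = [:-x, 1:] * ([:-x, 1:] * g)" by blast
    then have "poly (pderiv p) x = 0" by (simp add: pderiv_mult del: mult_pCons_left)
    then show False using der by simp
  qed
  have "A = mset_set (set_mset A)"
    using cnt by (intro multiset_eqI) (metis count_eq_zero_iff count_mset_set(1,3) finite_set_mset le_less_trans less_one nat_less_le not_less)
  then have "card (set_mset A) = ?Q" using A(1) deg by (metis size_mset_set)
  moreover have "set_mset A = frob_fixed n"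
  proof -
    have "poly p x = 0 \<longleftrightarrow> x \<in> set_mset A" for x
      using p0 by (subst A(2)) (auto simp: poly_prod_mset prod_mset_zero_iff image_iff)
    then show ?thesis by (auto simp: frob_fixed_def p_def poly_monom)
  qed
  ultimately show ?thesis by simp
qed

definition ac_scale :: "'a::field \<Rightarrow> 'a alg_closure \<Rightarrow> 'a alg_closure" where
  "ac_scale c x = to_ac c * x"

global_interpretation ac_vs: vector_space ac_scale
  by unfold_locales (simp_all add: ac_scale_def algebra_simps)

lemma frob_fixed_0: "0 \<in> frob_fixed n"
  by (simp add: frob_fixed_def)

lemma frob_fixed_add: "x \<in> frob_fixed n \<Longrightarrow> y \<in> frob_fixed n \<Longrightarrow> x + y \<in> frob_fixed n"
  by (simp add: frob_fixed_def frobenius_add)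

lemma frob_fixed_mult: "x \<in> frob_fixed n \<Longrightarrow> y \<in> frob_fixed n \<Longrightarrow> x * y \<in> frob_fixed n"
  by (simp add: frob_fixed_def power_mult_distrib)

lemma frob_fixed_to_ac: "to_ac c \<in> frob_fixed n"
  by (simp add: frob_fixed_def frobenius_to_ac)

lemma frob_fixed_diff:
  assumes "x \<in> frob_fixed n" "y \<in> frob_fixed n"
  shows "x - y \<in> frob_fixed n"
  using frob_fixed_add[OF assms(1) frob_fixed_mult[OF frob_fixed_to_ac[of "-1"] assms(2)]] by simp

lemma frob_fixed_power: "x \<in> frob_fixed n \<Longrightarrow> x ^ k \<in> frob_fixed n"
  by (simp add: frob_fixed_def flip: power_mult) (simp add: power_mult mult.commute[of k])

lemma frob_fixed_sum: "(\<And>i. i \<in> A \<Longrightarrow> f i \<in> frob_fixed n) \<Longrightarrow> sum f A \<in> frob_fixed n"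
  by (induction A rule: infinite_finite_induct) (auto simp: frob_fixed_0 frob_fixed_add)

lemma subspace_frob_fixed: "ac_vs.subspace (frob_fixed n)"
  by (auto simp: ac_vs.subspace_def ac_scale_def frob_fixed_0 intro: frob_fixed_add frob_fixed_mult frob_fixed_to_ac)

lemma finite_frob_fixed:
  assumes "0 < n"
  shows "finite (frob_fixed n :: 'a::{field,finite} alg_closure set)"
  using card_frob_fixed[OF assms, where 'a='a] by (intro card_ge_0_finite) simp

text \<open>
  A basis of the extension field over the ground field has \<open>n\<close> elements, by comparing
  cardinalities; it identifies vectors of length \<open>n\<close> with elements of the extension field.
\<close>

lemma frob_fixed_coordinates:
  "\<exists>\<phi> :: 'a::{field,finite} ^ 'n \<Rightarrow> 'a alg_closure.
     Vector_Spaces.linear (*s) ac_scale \<phi> \<and> bij_betw \<phi> UNIV (frob_fixed CARD('n))"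
proof -
  let ?L = "frob_fixed CARD('n) :: 'a alg_closure set"
  have fin: "finite ?L" by (simp add: finite_frob_fixed)
  obtain B where B: "B \<subseteq> ?L" "ac_vs.independent B" "?L \<subseteq> ac_vs.span B" "card B = ac_vs.dim ?L"
    using ac_vs.basis_exists by blast
  have finB: "finite B" using B(1) fin finite_subset by blast
  have "CARD('a) ^ CARD('n) = CARD('a) ^ card B"
    using ac_vs.card_finite_subspace[OF subspace_frob_fixed fin] B(4)
    by (simp add: card_frob_fixed)
  then have "card B = CARD('n)"
    using CARD_field_ge_2[where 'a='a] by (simp add: power_inject_exp)
  then obtain b :: "'n \<Rightarrow> 'a alg_closure" where b: "bij_betw b UNIV B"
    using finB by (metis finite_same_card_bij finite_class.finite_UNIV)
  define \<phi> where "\<phi> y = (\<Sum>i\<in>UNIV. ac_scale (y $ i) (b i))" for y :: "'a ^ 'n"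
  have lin: "Vector_Spaces.linear (*s) ac_scale \<phi>"
    by (intro Vector_Spaces.linear_iff[THEN iffD2])
      (auto simp: \<phi>_def vec.vector_space_axioms ac_vs.vector_space_axioms
        ac_vs.scale_left_distrib sum.distrib ac_vs.scale_sum_right)
  interpret \<phi>: Vector_Spaces.linear "(*s)" ac_scale \<phi> by (rule lin)
  have sub: "range \<phi> \<subseteq> ?L"
  proof safe
    fix y
    have "b i \<in> ?L" for i using b B(1) by (auto simp: bij_betw_def)
    then show "\<phi> y \<in> ?L"
      unfolding \<phi>_def by (intro ac_vs.subspace_sum ac_vs.subspace_scale subspace_frob_fixed)
  qed
  have "inj \<phi>"
  proof (rule \<phi>.inj_iff_eq_0[THEN iffD2], safe)
    fix y assume "\<phi> y = 0"
    then have "(\<Sum>v\<in>B. ac_scale (y $ inv_into UNIV b v) v) = 0"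
      unfolding \<phi>_def using b by (subst sum.reindex_bij_betw[OF b, symmetric]) (simp add: bij_betw_def)
    then have "y $ inv_into UNIV b v = 0" if "v \<in> B" for v
      using ac_vs.independentD[OF B(2) finB subset_refl, of "\<lambda>v. y $ inv_into UNIV b v"] that by simp
    then have "y $ i = 0" for i
      using b by (metis bij_betw_def inv_into_f_f UNIV_I rangeI)
    then show "y = 0" by (simp add: vec_eq_iff)
  qed
  moreover have "range \<phi> = ?L"
    using fin sub card_image[OF \<open>inj \<phi>\<close>]
    by (intro card_subset_eq) (simp_all add: card_frob_fixed)
  ultimately show ?thesis using lin by (auto simp: bij_betw_def)
qed

section \<open>Linearized polynomials\<close>

text \<open>
  A linearized polynomial with \<open>r\<close> coefficients. It acts as a linear map over the ground field,
  while its degree as a polynomial bounds the number of its roots, hence the size of its kernel.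
\<close>

definition linearized :: "nat \<Rightarrow> (nat \<Rightarrow> 'a::{field,finite} alg_closure) \<Rightarrow> 'a alg_closure \<Rightarrow> 'a alg_closure" where
  "linearized r a x = (\<Sum>i<r. a i * x ^ (CARD('a) ^ i))"

lemma linear_linearized: "Vector_Spaces.linear ac_scale ac_scale (linearized r a)"
  by (intro Vector_Spaces.linear_iff[THEN iffD2])
    (auto simp: linearized_def ac_vs.vector_space_axioms frobenius_add frobenius_to_ac ac_scale_def
      sum.distrib sum_distrib_left power_mult_distrib algebra_simps)

lemma linearized_frob_fixed:
  assumes "\<And>i. i < r \<Longrightarrow> a i \<in> frob_fixed n" "x \<in> frob_fixed n"
  shows "linearized r a x \<in> frob_fixed n"
  unfolding linearized_def using assms
  by (intro frob_fixed_sum frob_fixed_mult frob_fixed_power) auto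

lemma linearized_roots:
  fixes a :: "nat \<Rightarrow> 'a::{field,finite} alg_closure"
  assumes "i < r" "a i \<noteq> 0"
  shows "finite {x. linearized r a x = 0}" "card {x. linearized r a x = 0} \<le> CARD('a) ^ (r - 1)"
proof -
  let ?q = "CARD('a)"
  define p where "p = (\<Sum>i<r. monom (a i) (?q ^ i))"
  have eq: "poly p x = linearized r a x" for x
    by (simp add: p_def linearized_def poly_sum poly_monom)
  have q: "1 < ?q" using CARD_field_ge_2[where 'a='a] by simp
  have "coeff p (?q ^ i) = (\<Sum>j<r. if j = i then a j else 0)"
    unfolding p_def coeff_sum by (intro sum.cong) (use q in \<open>auto simp: power_inject_exp\<close>)
  also have "\<dots> = a i" using assms(1) by simp
  finally have p0: "p \<noteq> 0" using assms(2) by auto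
  have "degree p \<le> ?q ^ (r - 1)"
    unfolding p_def
  proof (rule degree_sum_le)
    fix j assume "j \<in> {..<r}"
    then have "?q ^ j \<le> ?q ^ (r - 1)" using q by (intro power_increasing) auto
    then show "degree (monom (a j) (?q ^ j)) \<le> ?q ^ (r - 1)"
      using degree_monom_le le_trans by blast
  qed simp
  then show "card {x. linearized r a x = 0} \<le> ?q ^ (r - 1)"
    using card_poly_roots_bound[OF p0] by (simp add: eq)
  show "finite {x. linearized r a x = 0}"
    using poly_roots_finite[OF p0] by (simp add: eq)
qed

section \<open>Gabidulin codes\<close>

locale extension_coordinates =
  fixes \<phi> :: "'a::{field,finite} ^ 'n \<Rightarrow> 'a alg_closure"
  assumes linear: "Vector_Spaces.linear (*s) ac_scale \<phi>"
    and bij: "bij_betw \<phi> UNIV (frob_fixed CARD('n))"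
begin

sublocale Vector_Spaces.linear "(*s)" ac_scale \<phi>
  by (rule linear)

text \<open>
  Row vectors act from the left because the column space of \<open>X\<close> is governed by the left kernel
  \<open>{y. y v* X = 0}\<close>: the roots of the polynomial become linear relations satisfied by all
  columns.
\<close>

definition represents :: "'a ^ 'n ^ 'n \<Rightarrow> nat \<Rightarrow> (nat \<Rightarrow> 'a alg_closure) \<Rightarrow> bool" where
  "represents X r a \<longleftrightarrow> (\<forall>y. \<phi> (y v* X) = linearized r a (\<phi> y))"

definition gabidulin :: "nat \<Rightarrow> ('a ^ 'n ^ 'n) set" where
  "gabidulin r = {X. \<exists>a. (\<forall>i<r. a i \<in> frob_fixed CARD('n)) \<and> represents X r a}"

lemma gabidulinI:
  "represents X r a \<Longrightarrow> (\<And>i. i < r \<Longrightarrow> a i \<in> frob_fixed CARD('n)) \<Longrightarrow> X \<in> gabidulin r"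
  by (auto simp: gabidulin_def)

lemma coordinates_eq_iff: "\<phi> x = \<phi> y \<longleftrightarrow> x = y"
  using bij by (auto simp: bij_betw_def inj_on_def)

lemma ex_represents:
  assumes "\<And>i. i < r \<Longrightarrow> a i \<in> frob_fixed CARD('n)"
  shows "\<exists>X. represents X r a"
proof -
  have range: "range \<phi> = frob_fixed CARD('n)" using bij by (simp add: bij_betw_def)
  interpret f: Vector_Spaces.linear ac_scale ac_scale "linearized r a" by (rule linear_linearized)
  define X where "X = (\<chi> i. inv_into UNIV \<phi> (linearized r a (\<phi> (axis i 1))))"
  have row: "\<phi> (X $ i) = linearized r a (\<phi> (axis i 1))" for i
    unfolding X_def vec_lambda_beta
    by (rule f_inv_into_f) (use range in \<open>auto intro!: linearized_frob_fixed assms\<close>)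
  have "\<phi> (y v* X) = linearized r a (\<phi> y)" for y
  proof -
    have "\<phi> (y v* X) = \<phi> (\<Sum>i\<in>UNIV. y $ i *s X $ i)"
      by (rule arg_cong[of _ _ \<phi>]) (simp add: vec_eq_iff vector_matrix_mult_def)
    also have "\<dots> = linearized r a (\<phi> (\<Sum>i\<in>UNIV. y $ i *s axis i 1))"
      by (simp add: sum scale row f.sum f.scale)
    finally show ?thesis by (simp add: basis_expansion)
  qed
  then show ?thesis by (auto simp: represents_def)
qed

lemma represents_unique:
  assumes "represents X r a" "represents Y r a"
  shows "X = Y"
proof -
  have "y v* X = y v* Y" for y
    using assms by (simp add: represents_def flip: coordinates_eq_iff)
  then have "transpose X *v y = transpose Y *v y" for y by simp
  then show ?thesis by (metis matrix_eq transpose_transpose)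
qed

text \<open>
  The left kernel of \<open>X\<close> embeds into the root set of a nonzero polynomial of degree at most
  \<open>q ^ (r - 1)\<close>, hence has dimension at most \<open>r - 1\<close>; rank-nullity turns this into a
  lower bound for the rank.
\<close>

lemma rank_represents:
  assumes "represents X r a" "i < r" "a i \<noteq> 0"
  shows "CARD('n) \<le> rank X + (r - 1)"
proof -
  let ?q = "CARD('a)" and ?K = "{y. y v* X = 0}"
  have "\<phi> ` ?K \<subseteq> {x. linearized r a x = 0}"
  proof safe
    fix y assume "y v* X = 0"
    then show "linearized r a (\<phi> y) = 0"
      using assms(1) zero unfolding represents_def by metis
  qed
  then have "card (\<phi> ` ?K) \<le> ?q ^ (r - 1)"
    using linearized_roots[of i r a, OF assms(2,3)] card_mono le_trans by blast
  moreover have "inj_on \<phi> ?K" using bij by (auto simp: bij_betw_def inj_on_def)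
  ultimately have K: "card ?K \<le> ?q ^ (r - 1)" by (simp add: card_image)
  have "range (\<lambda>y. y v* X) \<subseteq> vec.span (rows X)"
  proof safe
    fix y
    have "y v* X = (\<Sum>i\<in>UNIV. y $ i *s row i X)"
      by (simp add: vec_eq_iff vector_matrix_mult_def row_def)
    moreover have "row i X \<in> rows X" for i by (auto simp: rows_def)
    ultimately show "y v* X \<in> vec.span (rows X)"
      by (metis (no_types, lifting) vec.span_base vec.span_scale vec.span_sum)
  qed
  then have "card (range (\<lambda>y. y v* X)) \<le> card (vec.span (rows X))"
    by (intro card_mono) simp_all
  also have "\<dots> = ?q ^ rank X"
    by (simp add: vec.card_finite_subspace row_rank_def_gen)
  finally have R: "card (range (\<lambda>y. y v* X)) \<le> ?q ^ rank X" .
  have "?q ^ CARD('n) = CARD('a ^ 'n)" by simp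
  also have "\<dots> \<le> card (range (\<lambda>y. y v* X)) * card ?K"
    by (rule card_UNIV_le_range_times_kernel) (simp add: vector_matrix_mult_diff_distrib)
  also have "\<dots> \<le> ?q ^ rank X * ?q ^ (r - 1)" by (rule mult_le_mono[OF R K])
  finally have "?q ^ CARD('n) \<le> ?q ^ (rank X + (r - 1))" by (simp add: power_add)
  then show ?thesis
    using CARD_field_ge_2[where 'a='a] by (simp add: power_increasing_iff)
qed

lemma linearized_diff:
  "linearized r (\<lambda>i. a i - b i) x = linearized r a x - linearized r b x"
  by (simp add: linearized_def left_diff_distrib sum_subtractf)

lemma subspace_gabidulin: "mat_vs.subspace (gabidulin r)"
proof (unfold mat_vs.subspace_def, intro conjI ballI allI)
  have "represents 0 r (\<lambda>_. 0)" by (simp add: represents_def linearized_def zero)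
  then show "0 \<in> gabidulin r" by (rule gabidulinI) (rule frob_fixed_0)
next
  fix X Y assume "X \<in> gabidulin r" "Y \<in> gabidulin r"
  then obtain a b where a: "\<forall>i<r. a i \<in> frob_fixed CARD('n)" "represents X r a"
    and b: "\<forall>i<r. b i \<in> frob_fixed CARD('n)" "represents Y r b" by (auto simp: gabidulin_def)
  have "represents (X + Y) r (\<lambda>i. a i + b i)"
    using a(2) b(2)
    by (simp add: represents_def linearized_def vector_matrix_mult_add_rdistrib add distrib_right sum.distrib)
  then show "X + Y \<in> gabidulin r"
    by (rule gabidulinI) (use a(1) b(1) in \<open>simp add: frob_fixed_add\<close>)
next
  fix c X assume "X \<in> gabidulin r"
  then obtain a where a: "\<forall>i<r. a i \<in> frob_fixed CARD('n)" "represents X r a"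
    by (auto simp: gabidulin_def)
  have "y v* mat_scale c X = c *s (y v* X)" for y
    by (simp add: vec_eq_iff vector_matrix_mult_def mat_scale_def sum_distrib_left algebra_simps)
  then have "represents (mat_scale c X) r (\<lambda>i. to_ac c * a i)"
    using a(2) by (simp add: represents_def linearized_def scale ac_scale_def sum_distrib_left mult.assoc)
  then show "mat_scale c X \<in> gabidulin r"
    by (rule gabidulinI) (use a(1) in \<open>simp add: frob_fixed_mult frob_fixed_to_ac\<close>)
qed

text \<open>
  A codeword is determined by its \<open>r\<close> coefficients, each one of the \<open>q ^ n\<close> elements of the
  extension field.
\<close>

lemma card_gabidulin: "card (gabidulin r) \<le> CARD('a) ^ (CARD('n) * r)"
proof -
  let ?A = "{..<r} \<rightarrow>\<^sub>E (frob_fixed CARD('n) :: 'a alg_closure set)"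
  have fin: "finite (frob_fixed CARD('n) :: 'a alg_closure set)"
    by (rule finite_frob_fixed) simp
  have "gabidulin r \<subseteq> (\<lambda>a. SOME X. represents X r a) ` ?A"
  proof
    fix X assume "X \<in> gabidulin r"
    then obtain a where a: "\<forall>i<r. a i \<in> frob_fixed CARD('n)" "represents X r a"
      by (auto simp: gabidulin_def)
    have X: "represents X r (restrict a {..<r})"
      using a(2) by (simp add: represents_def linearized_def)
    then have "represents (SOME X. represents X r (restrict a {..<r})) r (restrict a {..<r})"
      by (rule someI)
    then have "X = (SOME X. represents X r (restrict a {..<r}))"
      using X by (rule represents_unique[rotated])
    then show "X \<in> (\<lambda>a. SOME X. represents X r a) ` ?A"
      using a(1) by (intro image_eqI[of _ _ "restrict a {..<r}"]) auto
  qed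
  then have "card (gabidulin r) \<le> card ?A"
    using fin by (intro surj_card_le finite_PiE) auto
  also have "\<dots> = CARD('a) ^ (CARD('n) * r)"
    by (simp add: card_PiE card_frob_fixed power_mult)
  finally show ?thesis .
qed

lemma rank_gabidulin:
  assumes "X \<in> gabidulin r" "X \<noteq> 0"
  shows "CARD('n) \<le> rank X + (r - 1)"
proof -
  obtain a where a: "represents X r a" using assms(1) by (auto simp: gabidulin_def)
  have "\<exists>i<r. a i \<noteq> 0"
  proof (rule ccontr)
    assume "\<not> (\<exists>i<r. a i \<noteq> 0)"
    then have "represents 0 r a" by (simp add: represents_def linearized_def zero)
    then show False using represents_unique[OF a] assms(2) by blast
  qed
  then show ?thesis using rank_represents[OF a] by blast
qed

text \<open>
  The subspace \<open>U\<close> is cut out by fewer than \<open>r\<close> linear equations. Requiring a linearized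
  polynomial to vanish at the points that correspond to the equations imposes fewer than \<open>r\<close>
  conditions over the extension field on \<open>r\<close> coefficients, so a nonzero solution exists. The
  columns of its matrix satisfy all the equations.
\<close>

lemma gabidulin_support_in:
  assumes "vec.subspace U" "CARD('n) < vec.dim U + r" "r \<le> CARD('n)"
  shows "\<exists>X\<in>gabidulin r. X \<noteq> 0 \<and> columns X \<subseteq> U"
proof -
  let ?L = "frob_fixed CARD('n) :: 'a alg_closure set"
  obtain P where P: "finite P" "card P \<le> CARD('n) - vec.dim U"
    and U: "\<And>x. (\<And>p. p \<in> P \<Longrightarrow> (\<Sum>i\<in>UNIV. p $ i * x $ i) = 0) \<Longrightarrow> x \<in> U"
    using subspace_equations[OF assms(1)] by blast
  \<comment> \<open>The solution comes from the pigeonhole principle: two coefficient vectors with the same values at the equations have a difference that vanishes there.\<close>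
  define ev where "ev a = restrict (\<lambda>p. linearized r a (\<phi> p)) P" for a
  have fin: "finite ?L" by (rule finite_frob_fixed) simp
  have \<phi>L: "\<phi> y \<in> ?L" for y using bij by (auto simp: bij_betw_def)
  have q: "1 < CARD('a)" using CARD_field_ge_2[where 'a='a] by simp
  have "ev ` ({..<r} \<rightarrow>\<^sub>E ?L) \<subseteq> P \<rightarrow>\<^sub>E ?L"
  proof (intro image_subsetI PiE_I)
    fix a p assume "a \<in> {..<r} \<rightarrow>\<^sub>E ?L" "p \<in> P"
    then show "ev a p \<in> ?L"
      by (auto simp: ev_def intro!: linearized_frob_fixed \<phi>L dest: PiE_mem)
  qed (simp add: ev_def)
  then have "card (ev ` ({..<r} \<rightarrow>\<^sub>E ?L)) \<le> card (P \<rightarrow>\<^sub>E ?L)"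
    using P(1) fin by (intro card_mono finite_PiE) auto
  also have "\<dots> = CARD('a) ^ (CARD('n) * card P)"
    by (simp add: card_PiE P(1) card_frob_fixed power_mult)
  also have "\<dots> < CARD('a) ^ (CARD('n) * r)"
    using P(2) assms(2) q dim_subset_UNIV_cart_gen[of U]
    by (intro power_strict_increasing) auto
  also have "\<dots> = card ({..<r} \<rightarrow>\<^sub>E ?L)"
    by (simp add: card_PiE card_frob_fixed power_mult)
  finally have "\<not> inj_on ev ({..<r} \<rightarrow>\<^sub>E ?L)" by (rule pigeonhole)
  then obtain a b where ab: "a \<in> {..<r} \<rightarrow>\<^sub>E ?L" "b \<in> {..<r} \<rightarrow>\<^sub>E ?L" "ev a = ev b" "a \<noteq> b"
    by (auto simp: inj_on_def)
  define c where "c i = a i - b i" for i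
  obtain i where i: "i < r" "c i \<noteq> 0"
    using ab(4) PiE_ext[OF ab(1,2)] by (auto simp: c_def)
  have cL: "c j \<in> ?L" if "j < r" for j
    using ab(1,2) that unfolding c_def by (intro frob_fixed_diff PiE_mem[of _ "{..<r}" "\<lambda>_. ?L"]) auto
  obtain X where X: "represents X r c" using ex_represents[of r c] cL by blast
  have "p v* X = 0" if "p \<in> P" for p
  proof -
    have "linearized r a (\<phi> p) = linearized r b (\<phi> p)"
      using fun_cong[OF ab(3), of p] that by (simp add: ev_def)
    then have "\<phi> (p v* X) = \<phi> 0"
      using X linearized_diff[of r a b "\<phi> p"] by (simp add: represents_def zero flip: c_def)
    then show ?thesis by (simp only: coordinates_eq_iff)
  qed
  then have "column k X \<in> U" for k
    by (intro U) (simp add: vec_eq_iff vector_matrix_mult_def column_def)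
  then have "columns X \<subseteq> U" by (auto simp: columns_def)
  moreover have "X \<noteq> 0"
    using rank_represents[OF X i] assms(3) i(1) rank_eq_0_iff[of X] by auto
  moreover have "X \<in> gabidulin r" using X cL by (rule gabidulinI)
  ultimately show ?thesis by blast
qed

end

text \<open>
  With \<open>r = n - d + 1\<close> the Gabidulin code has minimum distance at least \<open>d\<close>, and every
  subspace \<open>U\<close> of dimension \<open>d\<close> contains the support of a nonzero codeword. The distance bound
  leaves no room for a smaller support, so the support is \<open>U\<close> itself.
\<close>

lemma ex_code_holding_trivial_design:
  assumes "1 \<le> d" "d \<le> CARD('n)"
  shows "\<exists>G :: ('a::{field,finite} ^ 'n ^ 'n) set. mat_vs.subspace G \<and>
    card G \<le> CARD('a) ^ (CARD('n) * (CARD('n) - d + 1)) \<and>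
    (\<forall>X\<in>G. X \<noteq> 0 \<longrightarrow> d \<le> rank X) \<and>
    (\<forall>U. vec.subspace U \<and> vec.dim U = d \<longrightarrow> (\<exists>X\<in>G. rank X = d \<and> col_support X = U))"
proof -
  obtain \<phi> :: "'a ^ 'n \<Rightarrow> 'a alg_closure"
    where "Vector_Spaces.linear (*s) ac_scale \<phi>" "bij_betw \<phi> UNIV (frob_fixed CARD('n))"
    using frob_fixed_coordinates by blast
  then interpret extension_coordinates \<phi> by (rule extension_coordinates.intro)
  let ?r = "CARD('n) - d + 1"
  have min: "d \<le> rank X" if "X \<in> gabidulin ?r" "X \<noteq> 0" for X
    using rank_gabidulin[OF that] assms by simp
  have "\<exists>X\<in>gabidulin ?r. rank X = d \<and> col_support X = U" if U: "vec.subspace U" "vec.dim U = d" for U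
  proof -
    have "CARD('n) < vec.dim U + ?r" "?r \<le> CARD('n)" using U(2) assms by linarith+
    then obtain X where X: "X \<in> gabidulin ?r" "X \<noteq> 0" "columns X \<subseteq> U"
      using gabidulin_support_in[OF U(1)] by blast
    have sub: "col_support X \<subseteq> U"
      unfolding col_support_def using X(3) U(1) by (rule vec.span_minimal)
    have dim: "vec.dim (col_support X) = rank X"
      by (simp add: col_support_def rank_eq_dim_columns)
    have "col_support X = U"
      using min[OF X(1,2)] U dim sub
      by (intro vec.subspace_dim_equal) (auto simp: col_support_def)
    then show ?thesis using X(1) dim U(2) by auto
  qed
  then show ?thesis
    by (intro exI[of _ "gabidulin ?r"] conjI subspace_gabidulin card_gabidulin) (auto intro: min)
qed

section \<open>Padding with zero columns\<close>

definition pad_columns :: "('n \<Rightarrow> 'm) \<Rightarrow> 'a::field ^ 'n ^ 'k \<Rightarrow> 'a ^ 'm ^ 'k" where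
  "pad_columns \<iota> Y = (\<chi> i j. if j \<in> range \<iota> then Y $ i $ inv_into UNIV \<iota> j else 0)"

lemma pad_columns_nth: "inj \<iota> \<Longrightarrow> pad_columns \<iota> Y $ i $ \<iota> j = Y $ i $ j"
  by (simp add: pad_columns_def)

lemma pad_columns_outside: "j \<notin> range \<iota> \<Longrightarrow> pad_columns \<iota> Y $ i $ j = 0"
  by (simp add: pad_columns_def)

lemma span_columns_pad_columns:
  assumes "inj \<iota>"
  shows "vec.span (columns (pad_columns \<iota> Y)) = vec.span (columns Y)"
proof -
  have inside: "column (\<iota> j) (pad_columns \<iota> Y) = column j Y" for j
    using assms by (simp add: column_def pad_columns_nth)
  have outside: "column j (pad_columns \<iota> Y) = 0" if "j \<notin> range \<iota>" for j
    using that by (simp add: column_def pad_columns_outside vec_eq_iff)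
  have "insert 0 (columns (pad_columns \<iota> Y)) = insert 0 (columns Y)"
  proof (intro equalityI subsetI)
    fix v assume "v \<in> insert 0 (columns (pad_columns \<iota> Y))"
    then consider "v = 0" | j where "v = column j (pad_columns \<iota> Y)"
      by (auto simp: columns_def)
    then show "v \<in> insert 0 (columns Y)"
    proof cases
      case (2 j)
      then show ?thesis
        using inside outside[of j] by (cases "j \<in> range \<iota>") (auto simp: columns_def)
    qed simp
  next
    fix v assume "v \<in> insert 0 (columns Y)"
    then consider "v = 0" | j where "v = column (\<iota> j) (pad_columns \<iota> Y)"
      by (auto simp: columns_def inside)
    then show "v \<in> insert 0 (columns (pad_columns \<iota> Y))"
      by cases (auto simp: columns_def)
  qed
  then show ?thesis by (metis vec.span_insert_0)
qed

lemma pad_columns_eq_0_iff: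
  assumes "inj \<iota>"
  shows "pad_columns \<iota> Y = 0 \<longleftrightarrow> Y = 0"
proof
  assume "pad_columns \<iota> Y = 0"
  then have "pad_columns \<iota> Y $ i $ \<iota> j = 0" for i j by simp
  then show "Y = 0" by (simp add: pad_columns_nth[OF assms] vec_eq_iff)
qed (simp add: pad_columns_def vec_eq_iff)

lemma mat_scale_pad_columns: "mat_scale c (pad_columns \<iota> Y) = pad_columns \<iota> (mat_scale c Y)"
  by (simp add: mat_scale_def pad_columns_def vec_eq_iff)

lemma add_pad_columns: "pad_columns \<iota> Y + pad_columns \<iota> Z = pad_columns \<iota> (Y + Z)"
  by (simp add: pad_columns_def vec_eq_iff)

lemma subspace_pad_columns:
  assumes "mat_vs.subspace G"
  shows "mat_vs.subspace (pad_columns \<iota> ` G)"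
proof (unfold mat_vs.subspace_def, intro conjI ballI allI)
  have "pad_columns \<iota> 0 = 0" by (simp add: pad_columns_def vec_eq_iff)
  then show "0 \<in> pad_columns \<iota> ` G"
    using mat_vs.subspace_0[OF assms] by (metis imageI)
next
  fix X Y assume "X \<in> pad_columns \<iota> ` G" "Y \<in> pad_columns \<iota> ` G"
  then show "X + Y \<in> pad_columns \<iota> ` G"
    using mat_vs.subspace_add[OF assms] by (auto simp: add_pad_columns)
next
  fix c X assume "X \<in> pad_columns \<iota> ` G"
  then show "mat_scale c X \<in> pad_columns \<iota> ` G"
    using mat_vs.subspace_scale[OF assms] by (auto simp: mat_scale_pad_columns)
qed

lemma min_rank_dist_eqI:
  fixes C :: "('a::{field,finite} ^ 'm ^ 'n) set"
  assumes "X \<in> C" "X \<noteq> 0" "rank X = d" "\<And>X. X \<in> C \<Longrightarrow> X \<noteq> 0 \<Longrightarrow> d \<le> rank X"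
  shows "min_rank_dist C = d"
  unfolding min_rank_dist_def using assms by (intro Min_eqI) auto

text \<open>
  If every codeword vanishes in column \<open>k\<close>, every matrix that is zero outside that column is
  orthogonal to the code, and a matrix unit is such a matrix.
\<close>

lemma min_rank_dist_dual_zero_column:
  fixes C :: "('a::{field,finite} ^ 'm ^ 'n) set"
  assumes "\<And>X i. X \<in> C \<Longrightarrow> X $ i $ k = 0"
  shows "min_rank_dist (dual_code C) = 1"
proof -
  define i0 :: 'n where "i0 = undefined"
  define E :: "'a ^ 'm ^ 'n" where "E = (\<chi> i j. if i = i0 then axis k 1 $ j else 0)"
  have "E $ i0 $ k = 1" by (simp add: E_def axis_def)
  then have E0: "E \<noteq> 0" by (metis zero_index zero_neq_one)
  have "trace (X ** transpose E) = 0" if "X \<in> C" for X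
  proof -
    have "X $ i $ j * E $ i $ j = 0" for i j
      using assms[OF that] by (simp add: E_def axis_def)
    then show ?thesis
      by (auto simp: trace_def matrix_matrix_mult_def transpose_def intro!: sum.neutral)
  qed
  then have dual: "E \<in> dual_code C" by (simp add: dual_code_def)
  have "row i E = (if i = i0 then axis k 1 else 0)" for i
    by (simp add: row_def E_def vec_eq_iff)
  then have "rows E \<subseteq> vec.span {axis k 1}"
    by (auto simp: rows_def vec.span_base vec.span_zero)
  then have "rank E \<le> card {axis k (1 :: 'a)}"
    unfolding row_rank_def_gen by (rule vec.dim_le_card) simp
  then have "rank E \<le> 1" by simp
  then have "rank E = 1" using rank_eq_0_iff[of E] E0 by linarith
  then show ?thesis
    using dual E0 rank_eq_0_iff by (intro min_rank_dist_eqI[of E]) (auto simp: Suc_le_eq)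
qed

section \<open>A non-optimal code holding the trivial design\<close>

theorem proposition35:
  fixes d :: nat
  assumes "CARD('n::finite) \<ge> 2" and "CARD('m::finite) \<ge> 2"
    and "CARD('m) \<ge> CARD('n) + 1"
    and "1 \<le> d" and "d \<le> CARD('n) - 1"
  shows "\<exists>C :: ('a::{field,finite} ^ 'm ^ 'n) set.
           mat_vs.subspace C \<and> C \<noteq> {0} \<and> min_rank_dist C = d \<and>
           \<not> MRD C \<and>
           \<not> dually_QMRD C \<and>
           {col_support X | X. X \<in> C \<and> rank X = d} = {U. vec.subspace U \<and> vec.dim U = d}"
proof -
  have "d \<le> CARD('n)" using assms(5) by simp
  from ex_code_holding_trivial_design[OF assms(4) this, where 'a='a]
  obtain G :: "('a ^ 'n ^ 'n) set" where G: "mat_vs.subspace G"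
    "card G \<le> CARD('a) ^ (CARD('n) * (CARD('n) - d + 1))"
    and rk: "\<forall>X\<in>G. X \<noteq> 0 \<longrightarrow> d \<le> rank X"
    and supp: "\<forall>U. vec.subspace U \<and> vec.dim U = d \<longrightarrow> (\<exists>X\<in>G. rank X = d \<and> col_support X = U)"
    by (elim exE conjE)
  obtain \<iota> :: "'n \<Rightarrow> 'm" where \<iota>: "inj \<iota>"
    using inj_on_iff_card_le[of "UNIV :: 'n set" "UNIV :: 'm set"] assms(3) by auto
  have "card (range \<iota>) < CARD('m)" using \<iota> assms(3) by (simp add: card_image)
  then obtain k where k: "k \<notin> range \<iota>" by (metis UNIV_eq_I nat_less_le)
  define C where "C = pad_columns \<iota> ` G"
  have sub: "mat_vs.subspace C" unfolding C_def by (rule subspace_pad_columns[OF G(1)])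
  have supp_pad: "col_support (pad_columns \<iota> Y) = col_support Y" for Y :: "'a ^ 'n ^ 'n"
    by (simp add: col_support_def span_columns_pad_columns[OF \<iota>])
  have rank_pad: "rank (pad_columns \<iota> Y) = rank Y" for Y :: "'a ^ 'n ^ 'n"
    using supp_pad[of Y] unfolding col_support_def rank_eq_dim_columns by (metis vec.dim_span)
  have supp_iff: "{col_support X | X. X \<in> C \<and> rank X = d} = {U. vec.subspace U \<and> vec.dim U = d}"
  proof (intro equalityI subsetI)
    fix U assume "U \<in> {col_support X | X. X \<in> C \<and> rank X = d}"
    then show "U \<in> {U. vec.subspace U \<and> vec.dim U = d}"
      by (auto simp: col_support_def rank_eq_dim_columns)
  next
    fix U :: "('a ^ 'n) set" assume "U \<in> {U. vec.subspace U \<and> vec.dim U = d}"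
    then obtain Y where "Y \<in> G" "rank Y = d" "col_support Y = U" using supp by blast
    then show "U \<in> {col_support X | X. X \<in> C \<and> rank X = d}"
      using rank_pad supp_pad by (auto simp: C_def intro!: exI[of _ "pad_columns \<iota> Y"])
  qed
  obtain U :: "('a ^ 'n) set" where "vec.subspace U" "vec.dim U = d"
    using ex_subspace_dim[OF \<open>d \<le> CARD('n)\<close>, where 'a='a] by blast
  then obtain X where X: "X \<in> C" "rank X = d" using supp_iff by blast
  then have X0: "X \<noteq> 0" using assms(4) rank_eq_0_iff[of X] by auto
  have min: "min_rank_dist C = d"
    by (rule min_rank_dist_eqI[OF X(1) X0 X(2)])
      (auto simp: C_def rank_pad pad_columns_eq_0_iff[OF \<iota>] simp: rk)
  \<comment> \<open>An MRD code with these parameters would have dimension m (n - d + 1), but padding leaves the dimension at no more than n (n - d + 1).\<close>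
  have "CARD('a) ^ mat_vs.dim C = card C"
    by (rule mat_vs.card_finite_subspace[OF sub, symmetric]) simp
  also have "\<dots> \<le> card G" unfolding C_def by (rule card_image_le) simp
  finally have "CARD('a) ^ mat_vs.dim C \<le> CARD('a) ^ (CARD('n) * (CARD('n) - d + 1))"
    using G(2) by simp
  then have "mat_vs.dim C \<le> CARD('n) * (CARD('n) - d + 1)"
    using CARD_field_ge_2[where 'a='a] by (simp add: power_increasing_iff)
  also have "\<dots> < CARD('m) * (CARD('n) - d + 1)"
    using assms(3) by (intro mult_strict_right_mono) auto
  finally have "\<not> MRD C" using assms(3) by (simp add: MRD_def min)
  moreover have "min_rank_dist (dual_code C) = 1"
    by (rule min_rank_dist_dual_zero_column[of _ k]) (auto simp: C_def pad_columns_outside[OF k])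
  then have "\<not> dually_QMRD C" using assms by (simp add: dually_QMRD_def min)
  ultimately show ?thesis using sub X(1) X0 min supp_iff by blast
qed

end
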